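(* Let $q\in[0,1]$, $\delta_1,\dots,\delta_p\ge0$, and $\breve{\mathcal H}_0=\{i:|\beta_i|\le\delta_i\}$. Apply the fixed-X knockoff procedure with target FDR $q$, using antisymmetric statistics based on any estimator of the form $\mathcal E(\mathbf G,[\mathbf X\ \tilde{\mathbf X}]^\top\mathbf y)$, and let $\mathcal R$ be the set of selected variables. Then the FDR with respect to the composite nulls, $\mathsf{FDR}=\mathbb E\big(|\mathcal R\cap\breve{\mathcal H}_0|/(|\mathcal R|\vee1)\big)$, satisfies $$\mathsf{FDR}\le\min_{\epsilon\ge0}\left\{q\,e^{\epsilon}+\mathbb P\left(\frac1{\sigma^2}\max_{j\in\breve{\mathcal H}_0}\big\{\delta_j|\gamma_j-\gamma_j'|\big\}>\epsilon\right)\right\},$$ where $\begin{pmatrix}\boldsymbol\gamma_{p\times1}\\ \boldsymbol\gamma'_{p\times1}\end{pmatrix}=[\mathbf X\ \tilde{\mathbf X}]^\top\mathbf y$.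
   Context: Model: $\mathbf y=\mathbf X\boldsymbol\beta+\mathbf w$ with $\mathbf w\sim\mathcal N(0,\sigma^2\mathbf I_n)$, $\sigma^2>0$, $\mathbf X=[\mathbf X_1,\dots,\mathbf X_p]\in\mathbb R^{n\times p}$ a fixed (deterministic) design with $n\ge 2p$, columns of Euclidean norm $1$, and $\boldsymbol\Sigma=\mathbf X^\top\mathbf X$ invertible; $\boldsymbol\beta=(\beta_1,\dots,\beta_p)^\top\in\mathbb R^p$ is a fixed unknown vector. Knockoff matrix: fix $\mathbf s=(s_1,\dots,s_p)\in\mathbb R^p_+$ with $\mathrm{diag}(\mathbf s)\preceq 2\boldsymbol\Sigma$, and let $\tilde{\mathbf X}=\mathbf X(\mathbf I_p-\boldsymbol\Sigma^{-1}\mathrm{diag}(\mathbf s))+\tilde{\mathbf U}\mathbf C$, where $\tilde{\mathbf U}\in\mathbb R^{n\times p}$ has orthonormal columns with $\tilde{\mathbf U}^\top\mathbf X=0$, and $\mathbf C^\top\mathbf C=2\,\mathrm{diag}(\mathbf s)-\mathrm{diag}(\mathbf s)\boldsymbol\Sigma^{-1}\mathrm{diag}(\mathbf s)$. Then $$\mathbf G=[\mathbf X\ \tilde{\mathbf X}]^\top[\mathbf X\ \tilde{\mathbf X}]=\begin{bmatrix}\boldsymbol\Sigma&\boldsymbol\Sigma-\mathrm{diag}(\mathbf s)\\ \boldsymbol\Sigma-\mathrm{diag}(\mathbf s)&\boldsymbol\Sigma\end{bmatrix}.$$ Estimators: $\mathcal E$ is a deterministic (measurable) map producing a vector in $\mathbb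 R^{2p}$, written $(\hat\theta_1,\dots,\hat\theta_p,\hat\theta_1',\dots,\hat\theta_p')^\top$, and is assumed swap-equivariant: $P_i\,\mathcal E(\mathbf G,\mathbf z)=\mathcal E(\mathbf G,P_i\mathbf z)$ for all $\mathbf z\in\mathbb R^{2p}$ and $1\le i\le p$, where $P_i$ is the permutation matrix swapping entries $i$ and $i+p$. Antisymmetric statistics: $(W_1,\dots,W_p)$ is a function of the estimator such that, for any $F\subseteq\{1,\dots,p\}$, swapping $\hat\theta_i$ and $\hat\theta_i'$ for all $i\in F$ has the effect of switching the signs of $W_i$, $i\in F$ (leaving the other $W_i$ unchanged). Knockoff procedure with target FDR $q$: given $W_1,\dots,W_p$, let $\Phi=\{|W_j|:1\le j\le p\}\setminus\{0\}$ and $$T=\inf\Big\{t\in\Phi:\frac{1+\#\{j:W_j\le -t\}}{\#\{j:W_j\ge t\}\vee 1}\le q\Big\}$$ (with $\inf\emptyset=+\infty$); the procedure selects $\mathcal R=\{j:W_j\ge T\}$. *)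

theory Defs
  imports "HOL-Probability.Probability"
begin

text \<open>A vector in \<open>\<real>\<^sup>2\<^sup>p\<close> is indexed by \<^typ>\<open>'p + 'p\<close>: position \<open>i\<close> is \<open>Inl i\<close> and position
  \<open>i + p\<close> is \<open>Inr i\<close>.\<close>

definition gram :: "real^'k^'n::finite \<Rightarrow> real^'k^'k" where
  "gram A = Finite_Cartesian_Product.transpose A ** A"

definition diag_mat :: "real^'k \<Rightarrow> real^'k^'k" where
  "diag_mat s = (\<chi> i j. if i = j then s $ i else 0)"

definition hcat :: "real^'p^'n \<Rightarrow> real^'p^'n \<Rightarrow> real^('p + 'p)^'n" where
  "hcat A B = (\<chi> i k. case k of Inl j \<Rightarrow> A $ i $ j | Inr j \<Rightarrow> B $ i $ j)"

definition psd :: "real^'k^'k \<Rightarrow> bool" where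
  "psd A \<longleftrightarrow> Finite_Cartesian_Product.transpose A = A \<and> (\<forall>v. 0 \<le> v \<bullet> (A *v v))"

definition loewner_le :: "real^'k^'k \<Rightarrow> real^'k^'k \<Rightarrow> bool" (infix "\<preceq>\<^sub>L" 50) where
  "A \<preceq>\<^sub>L B \<longleftrightarrow> psd (B - A)"

text \<open>\<open>w\<close> has law \<open>\<N>(0, \<sigma>\<^sup>2 I\<^sub>n)\<close>; the third argument is the standard deviation.\<close>

definition isotropic_gaussian :: "'a measure \<Rightarrow> ('a \<Rightarrow> real^'n) \<Rightarrow> real \<Rightarrow> bool" where
  "isotropic_gaussian M w \<sigma> \<longleftrightarrow>
     distributed M lborel w (\<lambda>x. ennreal (\<Prod>i\<in>UNIV. normal_density 0 \<sigma> (x $ i)))"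

definition knockoff_matrix ::
  "real^'p^'n \<Rightarrow> real^'p \<Rightarrow> real^'p^'n \<Rightarrow> real^'p^'p \<Rightarrow> real^'p^'n" where
  "knockoff_matrix X s U C = X ** (mat 1 - matrix_inv (gram X) ** diag_mat s) + U ** C"

definition swap_index :: "'p set \<Rightarrow> 'p + 'p \<Rightarrow> 'p + 'p" where
  "swap_index F k = (case k of Inl j \<Rightarrow> if j \<in> F then Inr j else Inl j
                             | Inr j \<Rightarrow> if j \<in> F then Inl j else Inr j)"

definition swap_vec :: "'p set \<Rightarrow> real^('p::finite + 'p) \<Rightarrow> real^('p + 'p)" where
  "swap_vec F z = (\<chi> k. z $ swap_index F k)"

definition swap_matrix :: "'p \<Rightarrow> real^('p::finite + 'p)^('p + 'p)" where
  "swap_matrix i = (\<chi> k l. if l = swap_index {i} k then 1 else 0)"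

definition swap_equivariant :: "(real^('p::finite + 'p) \<Rightarrow> real^('p + 'p)) \<Rightarrow> bool" where
  "swap_equivariant e \<longleftrightarrow> (\<forall>i z. swap_matrix i *v e z = e (swap_matrix i *v z))"

definition antisymmetric_statistics :: "(real^('p::finite + 'p) \<Rightarrow> real^'p) \<Rightarrow> bool" where
  "antisymmetric_statistics W \<longleftrightarrow>
     (\<forall>F \<theta>. W (swap_vec F \<theta>) = (\<chi> j. if j \<in> F then - (W \<theta> $ j) else W \<theta> $ j))"

text \<open>The infimum is taken in \<^typ>\<open>ereal\<close>, so that it is \<open>\<infinity>\<close> when no threshold qualifies.\<close>

definition knockoff_threshold :: "real \<Rightarrow> real^'p \<Rightarrow> ereal" where
  "knockoff_threshold q W =
     Inf (ereal ` {t \<in> range (\<lambda>j. \<bar>W $ j\<bar>) - {0}.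
        (1 + real (card {j. W $ j \<le> - t})) / real (max (card {j. W $ j \<ge> t}) 1) \<le> q})"

definition knockoff_select :: "real \<Rightarrow> real^'p \<Rightarrow> 'p set" where
  "knockoff_select q W = {j. ereal (W $ j) \<ge> knockoff_threshold q W}"

definition FDR :: "'a measure \<Rightarrow> ('a \<Rightarrow> 'p set) \<Rightarrow> 'p set \<Rightarrow> real" where
  "FDR M R H = (\<integral>\<omega>. real (card (R \<omega> \<inter> H)) / real (max (card (R \<omega>)) 1) \<partial>M)"

text \<open>Maximum of a nonnegative family, with the convention that the maximum over the empty
  index set is \<open>0\<close> (\<^term>\<open>Max {}\<close> is unspecified); inserting \<open>0\<close> changes nothing otherwise.\<close>

definition max_over :: "'p set \<Rightarrow> ('p \<Rightarrow> real) \<Rightarrow> real" where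
  "max_over H f = Max (insert 0 (f ` H))"

end

theory Submission
  imports Defs
begin

text \<open>The Householder reflection along \<open>X\<^sub>j - X\<^sup>~\<^sub>j\<close> fixes all other columns of
  \<open>[X X\<^sup>~]\<close> and exchanges \<open>X\<^sub>j\<close> with its knockoff, so it flips the sign of \<open>W\<^sub>j\<close> only. It
  preserves Lebesgue measure and changes the Gaussian log-density of \<open>y\<close> by
  \<open>\<beta>\<^sub>j (\<gamma>\<^sub>j - \<gamma>'\<^sub>j) / \<sigma>\<^sup>2\<close>, which is at most \<open>\<epsilon>\<close> for a null \<open>j\<close> outside the exceptional
  event. Working with \<open>y\<close> rather than \<open>[X X\<^sup>~]\<^sup>T y\<close> covers the case of a singular Gram matrix.

  The false discovery proportion is at most \<open>q\<close> times a sum of weights over nulls with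
  \<open>W\<^sub>j > 0\<close>, where the weight of \<open>j\<close> uses the threshold computed from \<open>\<bar>W\<^sub>j\<bar>\<close> in place of \<open>W\<^sub>j\<close>
  (the leave-one-out argument of Barber, Candes and Samworth) and therefore ignores the sign of
  \<open>W\<^sub>j\<close>. The reflections trade it, at the cost of \<open>exp \<epsilon>\<close>, for the same sum over nulls with
  \<open>W\<^sub>j < 0\<close>, which never exceeds \<open>1\<close>.\<close>

subsection \<open>Selection by a leave-one-out threshold\<close>

text \<open>Erases the sign of the \<open>j\<close>-th statistic: whatever is computed from the
  result cannot tell \<open>W $ j\<close> from its negative.\<close>

definition abs_at :: "'p \<Rightarrow> real^'p \<Rightarrow> real^'p" where
  "abs_at j W = (\<chi> k. if k = j then \<bar>W $ j\<bar> else W $ k)"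

definition qualifies :: "real \<Rightarrow> real^'p::finite \<Rightarrow> real \<Rightarrow> bool" where
  "qualifies q W t \<longleftrightarrow> (1 + real (card {j. W $ j \<le> - t})) / real (max (card {j. W $ j \<ge> t}) 1) \<le> q"

text \<open>The \<open>1 +\<close> in the denominator plays two roles: it matches the one in the
  threshold ratio when \<open>W $ j\<close> is positive, and it counts \<open>j\<close> itself when
  \<open>W $ j\<close> is negative.\<close>

definition knockoff_weight :: "real \<Rightarrow> 'p set \<Rightarrow> 'p \<Rightarrow> real^'p::finite \<Rightarrow> real" where
  "knockoff_weight q H j W =
    (if knockoff_threshold q (abs_at j W) \<le> ereal \<bar>W $ j\<bar>
     then 1 / (1 + real (card {k \<in> H - {j}. knockoff_threshold q (abs_at j W) \<le> ereal (- W $ k)}))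
     else 0)"

text \<open>The candidates form a finite set, so the infimum is a minimum; over the empty set it is
  infinite and exceeds every real. Ranging over coordinates gives a finite disjunction, from which
  measurability also follows.\<close>

lemma knockoff_threshold_le_iff:
  "knockoff_threshold q W \<le> ereal a \<longleftrightarrow>
    (\<exists>k. W $ k \<noteq> 0 \<and> qualifies q W \<bar>W $ k\<bar> \<and> \<bar>W $ k\<bar> \<le> a)"
proof -
  let ?S = "{t \<in> range (\<lambda>j. \<bar>W $ j\<bar>) - {0}. qualifies q W t}"
  have T: "knockoff_threshold q W = Inf (ereal ` ?S)"
    by (simp add: knockoff_threshold_def qualifies_def)
  show ?thesis
  proof (cases "?S = {}")
    case True
    have "\<bar>W $ k\<bar> \<notin> ?S" for k unfolding True by simp
    then have "\<not> (W $ k \<noteq> 0 \<and> qualifies q W \<bar>W $ k\<bar>)" for k by simp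
    then show ?thesis unfolding T True by (auto simp: top_ereal_def)
  next
    case False
    have fin: "finite (ereal ` ?S)" by simp
    have "Inf (ereal ` ?S) = Min (ereal ` ?S)"
      using False fin by (intro cInf_eq_Min) auto
    then have "knockoff_threshold q W \<le> ereal a \<longleftrightarrow> (\<exists>t\<in>?S. t \<le> a)"
      unfolding T using False fin by (simp add: Min_le_iff)
    then show ?thesis by auto
  qed
qed

lemma knockoff_threshold_attained:
  assumes "knockoff_threshold q W \<le> ereal a"
  obtains t where "knockoff_threshold q W = ereal t" "0 < t" "t \<le> a" "qualifies q W t"
    "t \<in> range (\<lambda>j. \<bar>W $ j\<bar>)"
proof -
  obtain k0 where "W $ k0 \<noteq> 0" "qualifies q W \<bar>W $ k0\<bar>" "\<bar>W $ k0\<bar> \<le> a"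
    using assms knockoff_threshold_le_iff by blast
  define S where "S = {k. W $ k \<noteq> 0 \<and> qualifies q W \<bar>W $ k\<bar>}"
  have "k0 \<in> S" using \<open>W $ k0 \<noteq> 0\<close> \<open>qualifies q W \<bar>W $ k0\<bar>\<close> by (simp add: S_def)
  then obtain k where k: "k \<in> S" "\<And>i. i \<in> S \<Longrightarrow> \<bar>W $ k\<bar> \<le> \<bar>W $ i\<bar>"
    using ex_min_if_finite[of "(\<lambda>k. \<bar>W $ k\<bar>) ` S"] by (force simp: not_less)
  have le: "knockoff_threshold q W \<le> ereal \<bar>W $ k\<bar>"
    using k(1) by (auto simp: knockoff_threshold_le_iff S_def)
  have "ereal \<bar>W $ k\<bar> \<le> knockoff_threshold q W"
  proof (rule ereal_le_real)
    fix z assume "knockoff_threshold q W \<le> ereal z"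
    then obtain i where "i \<in> S" "\<bar>W $ i\<bar> \<le> z" by (auto simp: knockoff_threshold_le_iff S_def)
    then show "ereal \<bar>W $ k\<bar> \<le> ereal z" using k(2) by force
  qed
  with le have "knockoff_threshold q W = ereal \<bar>W $ k\<bar>" by simp
  moreover have "\<bar>W $ k\<bar> \<le> a" using k(2)[OF \<open>k0 \<in> S\<close>] \<open>\<bar>W $ k0\<bar> \<le> a\<close> by linarith
  ultimately show thesis using that k(1) by (auto simp: S_def)
qed

lemma knockoff_threshold_le_pos: "knockoff_threshold q W \<le> ereal a \<Longrightarrow> 0 < a"
  by (auto simp: knockoff_threshold_le_iff)

lemma knockoff_weight_nonneg: "0 \<le> knockoff_weight q H j W"
  by (simp add: knockoff_weight_def)

lemma abs_at_pos: "0 \<le> W $ j \<Longrightarrow> abs_at j W = W"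
  by (simp add: abs_at_def vec_eq_iff)

text \<open>Both the threshold and the comparison use only the absolute value of
  \<open>W $ j\<close>, and the count omits \<open>j\<close>.\<close>

lemma knockoff_weight_flip:
  "knockoff_weight q H j (\<chi> k. if k = j then - (W $ k) else W $ k) = knockoff_weight q H j W"
proof -
  have 1: "abs_at j (\<chi> k. if k = j then - (W $ k) else W $ k) = abs_at j W"
    by (simp add: abs_at_def vec_eq_iff)
  have 2: "{k \<in> H - {j}. t \<le> ereal (- (\<chi> k. if k = j then - (W $ k) else W $ k) $ k)} =
     {k \<in> H - {j}. t \<le> ereal (- W $ k)}" for t
    by auto
  show ?thesis unfolding knockoff_weight_def 1 2 by simp
qed

text \<open>For a selected null \<open>W $ j\<close> is positive, so its leave-one-out threshold is
  the actual threshold \<open>t\<close>, and all these weights equal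
  \<open>1 / (1 + card N)\<close>, with \<open>N\<close> the nulls at or below \<open>- t\<close>.
  As \<open>1 + card N\<close> is at most the numerator of the threshold ratio, its quotient by the
  number of selections is at most \<open>q\<close>.\<close>

lemma FDP_le_sum_weights:
  fixes W :: "real^'p::finite"
  assumes "0 \<le> q"
  shows "real (card (knockoff_select q W \<inter> H)) / real (max (card (knockoff_select q W)) 1)
    \<le> q * (\<Sum>j\<in>H. if 0 < W $ j then knockoff_weight q H j W else 0)"
proof (cases "knockoff_select q W = {}")
  case True
  then show ?thesis using assms by (simp add: sum_nonneg knockoff_weight_nonneg)
next
  case False
  let ?R = "knockoff_select q W"
  from False obtain i where "knockoff_threshold q W \<le> ereal (W $ i)"
    by (auto simp: knockoff_select_def)
  then obtain t where t: "knockoff_threshold q W = ereal t" "0 < t" "qualifies q W t"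
    using knockoff_threshold_attained by metis
  define N where "N = {k\<in>H. t \<le> - W $ k}"
  have R: "?R = {j. W $ j \<ge> t}" by (simp add: knockoff_select_def t(1))
  have w: "(if 0 < W $ j then knockoff_weight q H j W else 0) = (if j \<in> ?R then 1 / (1 + card N) else 0)"
    if "j \<in> H" for j
  proof (cases "0 < W $ j")
    case True
    \<comment> \<open>A positive \<open>W $ j\<close> cannot lie at or below \<open>- t\<close>, so
      leaving out \<open>j\<close> loses nothing and the denominator is the same for all such
      \<open>j\<close>.\<close>
    have "{k \<in> H - {j}. t \<le> - W $ k} = N" using True t(2) by (auto simp: N_def)
    then show ?thesis using True by (simp add: knockoff_weight_def abs_at_pos t(1) R)
  next
    case False
    then show ?thesis using t(2) by (simp add: R)
  qed
  have "(\<Sum>j\<in>H. if 0 < W $ j then knockoff_weight q H j W else 0)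
      = (\<Sum>j\<in>H. if j \<in> ?R then 1 / (1 + card N) else 0)"
    by (rule sum.cong) (simp_all add: w)
  also have "\<dots> = real (card (?R \<inter> H)) / (1 + card N)"
    by (simp add: sum.If_cases Int_commute)
  finally have s: "(\<Sum>j\<in>H. if 0 < W $ j then knockoff_weight q H j W else 0)
    = real (card (?R \<inter> H)) / (1 + card N)" .
  have "card N \<le> card {j. W $ j \<le> - t}" by (rule card_mono) (auto simp: N_def)
  then have "(1 + card N) / real (max (card ?R) 1) \<le> (1 + real (card {j. W $ j \<le> - t})) / real (max (card ?R) 1)"
    by (intro divide_right_mono) auto
  also have "\<dots> \<le> q" using t(3) by (simp add: qualifies_def R)
  finally have "(1 + card N) / real (max (card ?R) 1) \<le> q" .
  then have "(1 + card N) / real (max (card ?R) 1) * (real (card (?R \<inter> H)) / (1 + card N))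
     \<le> q * (real (card (?R \<inter> H)) / (1 + card N))"
    by (rule mult_right_mono) simp
  then show ?thesis unfolding s by (simp add: add_nonneg_eq_0_iff)
qed

text \<open>If two coordinates lie below the negatives of their thresholds, flipping either one to
  its absolute value produces the same two counts, so the smaller threshold qualifies for both.\<close>
lemma leave_one_out_le:
  fixes W :: "real^'p::finite"
  assumes j: "knockoff_threshold q (abs_at j W) \<le> ereal (- W $ j)"
    and k: "knockoff_threshold q (abs_at j W) \<le> ereal (- W $ k)"
  shows "knockoff_threshold q (abs_at k W) \<le> knockoff_threshold q (abs_at j W)"
proof -
  obtain t where t: "knockoff_threshold q (abs_at j W) = ereal t" "0 < t" "t \<le> - W $ j"
    "qualifies q (abs_at j W) t" "t \<in> range (\<lambda>i. \<bar>abs_at j W $ i\<bar>)"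
    using knockoff_threshold_attained[OF j] by metis
  have tk: "t \<le> - W $ k" using k t(1) by simp
  have ab: "\<bar>abs_at i W $ l\<bar> = \<bar>W $ l\<bar>" for i l by (simp add: abs_at_def)
  obtain l where l: "t = \<bar>W $ l\<bar>" using t(5) by (auto simp: ab)
  \<comment> \<open>One of the two modified vectors is at least \<open>t\<close> at \<open>j\<close>
    and at most \<open>- t\<close> at \<open>k\<close>, the other the reverse; elsewhere they agree.
    Exchanging \<open>j\<close> and \<open>k\<close> therefore matches the two counts.\<close>
  let ?s = "Transposition.transpose j k"
  have "card {i. abs_at k W $ i \<le> - t} = card (?s ` {i. abs_at j W $ i \<le> - t})"
    by (rule arg_cong[of _ _ card]) (use t(2,3) tk in
      \<open>auto simp: abs_at_def image_iff Transposition.transpose_def split: if_splits\<close>)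
  also have "\<dots> = card {i. abs_at j W $ i \<le> - t}"
    by (rule card_image) simp
  finally have 1: "card {i. abs_at k W $ i \<le> - t} = card {i. abs_at j W $ i \<le> - t}" .
  have "card {i. abs_at k W $ i \<ge> t} = card (?s ` {i. abs_at j W $ i \<ge> t})"
    by (rule arg_cong[of _ _ card]) (use t(2,3) tk in
      \<open>auto simp: abs_at_def image_iff Transposition.transpose_def split: if_splits\<close>)
  also have "\<dots> = card {i. abs_at j W $ i \<ge> t}"
    by (rule card_image) simp
  finally have 2: "card {i. abs_at k W $ i \<ge> t} = card {i. abs_at j W $ i \<ge> t}" .
  have "qualifies q (abs_at k W) t" using t(4) by (simp add: qualifies_def 1 2)
  \<comment> \<open>Absolute values are the same in both modified vectors, so \<open>t\<close> is
    still a candidate, attained at \<open>l\<close>.\<close>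
  then have "\<exists>i. abs_at k W $ i \<noteq> 0 \<and> qualifies q (abs_at k W) \<bar>abs_at k W $ i\<bar> \<and> \<bar>abs_at k W $ i\<bar> \<le> t"
    using l t(2) by (intro exI[of _ l]) (auto simp: ab abs_at_def)
  then show ?thesis by (simp add: t(1) knockoff_threshold_le_iff)
qed

text \<open>Only indices in \<open>S\<close> have a nonzero weight, and each of their denominators
  counts all of \<open>S\<close>: any two members have the same threshold or lie far enough below
  both. Hence at most \<open>card S\<close> terms of size at most \<open>1 / card S\<close>.\<close>

lemma sum_negative_weights_le_1:
  fixes W :: "real^'p::finite"
  shows "(\<Sum>j\<in>H. if W $ j < 0 then knockoff_weight q H j W else 0) \<le> 1"
proof -
  let ?T = "\<lambda>j. knockoff_threshold q (abs_at j W)"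
  define S where "S = {j\<in>H. ?T j \<le> ereal (- W $ j)}"
  have w: "(if W $ j < 0 then knockoff_weight q H j W else 0) \<le> (if j \<in> S then 1 / card S else 0)"
    if jH: "j \<in> H" for j
  proof (cases "j \<in> S")
    case True
    then have Tj: "?T j \<le> ereal (- W $ j)" by (simp add: S_def)
    have neg: "W $ j < 0" using knockoff_threshold_le_pos[OF Tj] by simp
    have sub: "S - {j} \<subseteq> {k \<in> H - {j}. ?T j \<le> ereal (- W $ k)}"
    proof safe
      fix k assume "k \<in> S" "k \<noteq> j"
      then have Tk: "?T k \<le> ereal (- W $ k)" by (simp add: S_def)
      show "k \<in> H" using \<open>k \<in> S\<close> by (simp add: S_def)
      show "?T j \<le> ereal (- W $ k)"
      proof (cases "?T j \<le> ?T k")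
        case True then show ?thesis using Tk by (rule order_trans)
      next
        case False
        \<comment> \<open>If \<open>?T k\<close> were the smaller threshold, \<open>j\<close> would
          lie below its negative too, and the exchange argument started from \<open>k\<close> would
          give the opposite inequality.\<close>
        then have "?T k \<le> ereal (- W $ j)" using Tj by (meson linear order_trans)
        then have "?T j \<le> ?T k" using leave_one_out_le[OF Tk] by blast
        then show ?thesis using False by simp
      qed
    qed
    have "card S = 1 + card (S - {j})" using True card.remove[of S j] by simp
    also have "\<dots> \<le> 1 + card {k \<in> H - {j}. ?T j \<le> ereal (- W $ k)}"
      using card_mono[OF _ sub] by simp
    finally have "real (card S) \<le> 1 + real (card {k \<in> H - {j}. ?T j \<le> ereal (- W $ k)})" by linarith
    moreover have "0 < card S" using True by (auto simp: card_gt_0_iff)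
    ultimately show ?thesis using True neg Tj
      by (simp add: knockoff_weight_def frac_le)
  next
    case False
    then show ?thesis using jH by (auto simp: S_def knockoff_weight_def)
  qed
  have "(\<Sum>j\<in>H. if W $ j < 0 then knockoff_weight q H j W else 0) \<le> (\<Sum>j\<in>H. if j \<in> S then 1 / card S else 0)"
    by (rule sum_mono) (rule w)
  also have "\<dots> = (\<Sum>j\<in>S. 1 / card S)"
    by (rule sum.mono_neutral_cong_right) (auto simp: S_def)
  \<comment> \<open>The sum is \<open>1\<close>, or \<open>0\<close> when \<open>S\<close> is
    empty.\<close>
  also have "\<dots> \<le> 1" by simp
  finally show ?thesis .
qed

subsection \<open>Measurability\<close>

lemma borel_measurable_vec_nth [measurable (raw)]:
  "f \<in> borel_measurable M \<Longrightarrow> (\<lambda>x. (f x :: real^'p::finite) $ i) \<in> borel_measurable M"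
  by (rule measurable_compose[of f M borel])
     (simp_all add: borel_measurable_continuous_onI continuous_on_component)

lemma borel_measurable_card_Collect [measurable (raw)]:
  assumes "\<And>j. Measurable.pred M (P j)"
  shows "(\<lambda>x. real (card {j::'p::finite. P j x})) \<in> borel_measurable M"
proof -
  have "real (card {j. P j x}) = (\<Sum>j\<in>UNIV. if P j x then 1 else 0)" for x
    by (simp add: sum.If_cases)
  then show ?thesis using assms by simp
qed

lemma measurable_qualifies [measurable (raw)]:
  assumes [measurable]: "f \<in> borel_measurable M" "t \<in> borel_measurable M"
  shows "Measurable.pred M (\<lambda>x. qualifies q (f x) (t x))"
  unfolding qualifies_def of_nat_max by measurable

lemma measurable_knockoff_threshold_le [measurable (raw)]:
  assumes [measurable]: "f \<in> borel_measurable M" "a \<in> borel_measurable M"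
  shows "Measurable.pred M (\<lambda>x. knockoff_threshold q (f x) \<le> ereal (a x))"
  unfolding knockoff_threshold_le_iff by measurable

lemma borel_measurable_abs_at [measurable (raw)]:
  assumes [measurable]: "f \<in> borel_measurable M"
  shows "(\<lambda>x. abs_at j (f x)) \<in> borel_measurable M"
proof -
  \<comment> \<open>Adding a multiple of a coordinate vector expresses the change by measurable
    vector operations.\<close>
  have "abs_at j V = V + (\<bar>V $ j\<bar> - V $ j) *\<^sub>R axis j 1" for V
    by (auto simp: abs_at_def vec_eq_iff axis_def)
  then show ?thesis by simp
qed

lemma borel_measurable_knockoff_weight [measurable (raw)]:
  assumes [measurable]: "f \<in> borel_measurable M"
  shows "(\<lambda>x. knockoff_weight q H j (f x)) \<in> borel_measurable M"
  unfolding knockoff_weight_def by measurable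

lemma borel_measurable_FDP [measurable (raw)]:
  assumes [measurable]: "f \<in> borel_measurable M"
  shows "(\<lambda>x. real (card (knockoff_select q (f x) \<inter> H)) /
    real (max (card (knockoff_select q (f x))) 1)) \<in> borel_measurable M"
  unfolding knockoff_select_def Int_def mem_Collect_eq of_nat_max by measurable

subsection \<open>Orthogonal invariance of the Gaussian law\<close>

lemma nn_integral_lborel_translate:
  fixes c :: "'a::euclidean_space"
  assumes [measurable]: "f \<in> borel_measurable borel"
  shows "(\<integral>\<^sup>+x. f (c + x) \<partial>lborel) = (\<integral>\<^sup>+x. f x \<partial>lborel)"
  using nn_integral_distr[of "(+) c" lborel borel f] by (simp add: lborel_distr_plus)

text \<open>Integrating \<open>indicator A (f x) * indicator B y\<close> for the unit ball \<open>B\<close> over both variables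
  and shifting first \<open>x\<close>, then \<open>y\<close>, exchanges the roles of \<open>f\<close> and the identity.\<close>
lemma lborel_distr_orthogonal:
  fixes f :: "'a::euclidean_space \<Rightarrow> 'a"
  assumes f: "orthogonal_transformation f"
  shows "distr lborel borel f = lborel"
proof (rule measure_eqI)
  fix A assume "A \<in> sets (distr lborel borel f)"
  then have A[measurable]: "A \<in> sets borel" by simp
  have lin: "linear f" using f by (rule orthogonal_transformation_linear)
  have [measurable]: "f \<in> borel_measurable borel"
    by (intro borel_measurable_continuous_onI linear_continuous_on linear_conv_bounded_linear[THEN iffD1] lin)
  \<comment> \<open>A preimage of \<open>y\<close> turns a shift of the argument of \<open>f\<close>
    by \<open>g y\<close> into a shift of its value by \<open>y\<close>.\<close>
  obtain g where g: "\<And>y. f (g y) = y"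
    using orthogonal_transformation_surj[OF f] by (metis surj_def)
  define B where "B = ball (0::'a) 1"
  have [measurable]: "B \<in> sets borel" by (simp add: B_def)
  have fg: "f (g y + x) = y + f x" for x y using lin by (simp add: linear_add g)
  have "emeasure (distr lborel borel f) A * emeasure lborel B
      = (\<integral>\<^sup>+y. indicator B y * (\<integral>\<^sup>+x. indicator A (f x) \<partial>lborel) \<partial>lborel)"
    by (simp add: nn_integral_multc emeasure_distr nn_integral_indicator[symmetric]
          mult.commute nn_integral_distr del: nn_integral_indicator)
  also have "\<dots> = (\<integral>\<^sup>+y. indicator B y * (\<integral>\<^sup>+x. indicator A (y + f x) \<partial>lborel) \<partial>lborel)"
  proof -
    have "(\<integral>\<^sup>+x. indicator A (f x) \<partial>lborel) = (\<integral>\<^sup>+x. indicator A (y + f x) \<partial>lborel)" for y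
      by (subst nn_integral_lborel_translate[symmetric, of _ "g y"]) (simp_all add: fg)
    then show ?thesis by simp
  qed
  also have "\<dots> = (\<integral>\<^sup>+y. (\<integral>\<^sup>+x. indicator B y * indicator A (y + f x) \<partial>lborel) \<partial>lborel)"
    by (simp add: nn_integral_cmult)
  also have "\<dots> = (\<integral>\<^sup>+x. (\<integral>\<^sup>+y. indicator B y * indicator A (y + f x) \<partial>lborel) \<partial>lborel)"
    by (intro lborel_pair.Fubini') simp
  also have "\<dots> = (\<integral>\<^sup>+x. (\<integral>\<^sup>+y. indicator B (y - f x) * indicator A y \<partial>lborel) \<partial>lborel)"
  proof -
    have "(\<integral>\<^sup>+y. indicator B y * indicator A (y + f x) \<partial>lborel)
        = (\<integral>\<^sup>+y. indicator B (y - f x) * indicator A y \<partial>lborel)" for x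
      by (subst nn_integral_lborel_translate[symmetric, of _ "- f x"]) simp_all
    then show ?thesis by simp
  qed
  also have "\<dots> = (\<integral>\<^sup>+y. (\<integral>\<^sup>+x. indicator B (y - f x) * indicator A y \<partial>lborel) \<partial>lborel)"
    by (intro lborel_pair.Fubini') simp
  also have "\<dots> = (\<integral>\<^sup>+y. (\<integral>\<^sup>+x. indicator B x \<partial>lborel) * indicator A y \<partial>lborel)"
  proof -
    \<comment> \<open>The left side is the norm of \<open>- f x\<close>; the ball is centred at the
      origin, so membership depends on the norm alone.\<close>
    have "norm (y - f (g y + x)) = norm x" for x y
      using orthogonal_transformation_norm[OF f] by (simp add: fg)
    then have "indicator B (y - f (g y + x)) = (indicator B x :: ennreal)" for x y
      by (simp add: B_def indicator_def)
    then have "(\<integral>\<^sup>+x. indicator B (y - f x) \<partial>lborel) = (\<integral>\<^sup>+x. indicator B x \<partial>lborel)" for y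
      by (subst nn_integral_lborel_translate[symmetric, of _ "g y"]) simp_all
    then show ?thesis by (simp add: nn_integral_multc)
  qed
  also have "\<dots> = emeasure lborel A * emeasure lborel B"
    by (subst nn_integral_cmult) (simp_all add: mult.commute)
  finally have *: "emeasure (distr lborel borel f) A * emeasure lborel B = emeasure lborel A * emeasure lborel B" .
  \<comment> \<open>The common factor can be cancelled because it is neither \<open>0\<close> nor
    infinite.\<close>
  have "emeasure lborel B = ennreal (unit_ball_vol (real DIM('a)))" "0 < unit_ball_vol (real DIM('a))"
    by (simp_all add: B_def emeasure_ball)
  with * show "emeasure (distr lborel borel f) A = emeasure lborel A"
    by (simp add: mult_right_ennreal_cancel)
qed simp

lemma nn_integral_lborel_orthogonal:
  fixes h :: "'a::euclidean_space \<Rightarrow> 'a"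
  assumes h: "orthogonal_transformation h" and [measurable]: "f \<in> borel_measurable borel"
  shows "(\<integral>\<^sup>+x. f (h x) \<partial>lborel) = (\<integral>\<^sup>+x. f x \<partial>lborel)"
proof -
  have "h \<in> borel_measurable borel"
    using orthogonal_transformation_linear[OF h]
    by (intro borel_measurable_continuous_onI linear_continuous_on) (simp add: linear_conv_bounded_linear)
  then show ?thesis using nn_integral_distr[of h lborel borel f] by (simp add: lborel_distr_orthogonal[OF h])
qed

section \<open>Gaussian densities compared under a reflection\<close>

lemma prod_normal_density:
  fixes x :: "real^'n::finite"
  shows "(\<Prod>i\<in>UNIV. normal_density 0 \<sigma> (x $ i)) =
    (1 / sqrt (2 * pi * \<sigma>\<^sup>2)) ^ CARD('n) * exp (- (norm x)\<^sup>2 / (2 * \<sigma>\<^sup>2))"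
proof -
  have "(norm x)\<^sup>2 = (\<Sum>i\<in>UNIV. (x $ i)\<^sup>2)"
    by (simp add: norm_vec_def L2_set_def sum_nonneg)
  then show ?thesis
    by (simp add: normal_density_def prod.distrib prod_dividef exp_sum[symmetric] sum_divide_distrib sum_negf power_divide)
qed

text \<open>The density depends on the distance to \<open>\<mu>\<close> only, so \<open>le\<close>
  bounds the density at \<open>v\<close> by \<open>exp \<epsilon>\<close> times that at
  \<open>Q v\<close> wherever \<open>f\<close> does not vanish. Substituting \<open>Q v\<close> for
  \<open>v\<close>, which preserves Lebesgue measure, moves the reflection from the density to
  \<open>f\<close>.\<close>

lemma gaussian_reflection_comparison:
  fixes w :: "'a \<Rightarrow> real^'n::finite" and f :: "real^'n \<Rightarrow> ennreal" and Q :: "real^'n \<Rightarrow> real^'n"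
  assumes w: "isotropic_gaussian M w \<sigma>" and \<sigma>: "0 < \<sigma>"
    and Q: "orthogonal_transformation Q" and QQ: "\<And>v. Q (Q v) = v"
    and f[measurable]: "f \<in> borel_measurable borel"
    and le: "\<And>v. f v \<noteq> 0 \<Longrightarrow> (norm (Q v - \<mu>))\<^sup>2 - (norm (v - \<mu>))\<^sup>2 \<le> 2 * \<sigma>\<^sup>2 * \<epsilon>"
  shows "(\<integral>\<^sup>+\<omega>. f (\<mu> + w \<omega>) \<partial>M) \<le> ennreal (exp \<epsilon>) * (\<integral>\<^sup>+\<omega>. f (Q (\<mu> + w \<omega>)) \<partial>M)"
proof -
  define \<phi> where "\<phi> x = (1 / sqrt (2 * pi * \<sigma>\<^sup>2)) ^ CARD('n) * exp (- (norm x)\<^sup>2 / (2 * \<sigma>\<^sup>2))"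
    for x :: "real^'n"
  have [measurable]: "\<phi> \<in> borel_measurable borel" unfolding \<phi>_def by measurable
  have [measurable]: "Q \<in> borel_measurable borel"
    using orthogonal_transformation_linear[OF Q]
    by (intro borel_measurable_continuous_onI linear_continuous_on) (simp add: linear_conv_bounded_linear)
  have law: "(\<integral>\<^sup>+\<omega>. h (\<mu> + w \<omega>) \<partial>M) = (\<integral>\<^sup>+v. \<phi> (v - \<mu>) * h v \<partial>lborel)"
    if [measurable]: "h \<in> borel_measurable borel" for h :: "real^'n \<Rightarrow> ennreal"
  proof -
    have "(\<integral>\<^sup>+\<omega>. h (\<mu> + w \<omega>) \<partial>M) = (\<integral>\<^sup>+x. \<phi> x * h (\<mu> + x) \<partial>lborel)"
      using w unfolding isotropic_gaussian_def prod_normal_density \<phi>_def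
      by (subst distributed_nn_integral[symmetric, of M lborel w]) auto
    also have "\<dots> = (\<integral>\<^sup>+v. \<phi> (v - \<mu>) * h v \<partial>lborel)"
      by (subst nn_integral_lborel_translate[symmetric, of _ \<mu>]) simp_all
    finally show ?thesis .
  qed
  have "(\<integral>\<^sup>+\<omega>. f (\<mu> + w \<omega>) \<partial>M) = (\<integral>\<^sup>+v. \<phi> (v - \<mu>) * f v \<partial>lborel)"
    by (rule law) simp
  also have "\<dots> \<le> (\<integral>\<^sup>+v. ennreal (exp \<epsilon>) * (\<phi> (Q v - \<mu>) * f v) \<partial>lborel)"
  proof (rule nn_integral_mono)
    fix v :: "real^'n"
    show "\<phi> (v - \<mu>) * f v \<le> ennreal (exp \<epsilon>) * (\<phi> (Q v - \<mu>) * f v)"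
    proof (cases "f v = 0")
      case False
      have "- (norm (v - \<mu>))\<^sup>2 / (2 * \<sigma>\<^sup>2) \<le> \<epsilon> + - (norm (Q v - \<mu>))\<^sup>2 / (2 * \<sigma>\<^sup>2)"
        using le[OF False] \<sigma> by (simp add: field_simps)
      then have "exp (- (norm (v - \<mu>))\<^sup>2 / (2 * \<sigma>\<^sup>2)) \<le> exp \<epsilon> * exp (- (norm (Q v - \<mu>))\<^sup>2 / (2 * \<sigma>\<^sup>2))"
        by (simp add: exp_add[symmetric])
      then have "\<phi> (v - \<mu>) \<le> exp \<epsilon> * \<phi> (Q v - \<mu>)"
        unfolding \<phi>_def mult.left_commute[of "exp \<epsilon>"] by (rule mult_left_mono) simp
      then have "ennreal (\<phi> (v - \<mu>)) \<le> ennreal (exp \<epsilon>) * ennreal (\<phi> (Q v - \<mu>))"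
        by (simp add: ennreal_mult'[symmetric] ennreal_leI)
      then show ?thesis by (simp add: mult.assoc[symmetric] mult_right_mono)
    qed simp
  qed
  also have "\<dots> = ennreal (exp \<epsilon>) * (\<integral>\<^sup>+v. \<phi> (Q v - \<mu>) * f v \<partial>lborel)"
    by (rule nn_integral_cmult) simp
  also have "(\<integral>\<^sup>+v. \<phi> (Q v - \<mu>) * f v \<partial>lborel) = (\<integral>\<^sup>+v. \<phi> (v - \<mu>) * f (Q v) \<partial>lborel)"
    by (subst nn_integral_lborel_orthogonal[OF Q, symmetric]) (simp_all add: QQ)
  also have "\<dots> = (\<integral>\<^sup>+\<omega>. f (Q (\<mu> + w \<omega>)) \<partial>M)"
    by (rule law[symmetric]) simp
  finally show ?thesis .
qed

subsection \<open>Reflections exchanging a variable with its knockoff\<close>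

lemma matrix_diff_ldistrib: "A ** (B - C) = A ** B - A ** (C :: 'a::ring_1^'p^'n)"
  by (vector matrix_matrix_mult_def sum_subtractf[symmetric] right_diff_distrib)

lemma matrix_diff_rdistrib: "(A - B) ** C = A ** C - B ** (C :: 'a::ring_1^'p^'n)"
  by (vector matrix_matrix_mult_def sum_subtractf[symmetric] left_diff_distrib)

lemma matrix_add_rdistrib: "(A + B) ** C = A ** C + B ** (C :: 'a::semiring_1^'p^'n)"
  by (vector matrix_matrix_mult_def sum.distrib[symmetric] distrib_right)

lemma transpose_add: "Finite_Cartesian_Product.transpose (A + B) =
    Finite_Cartesian_Product.transpose A + Finite_Cartesian_Product.transpose B"
  by (simp add: Finite_Cartesian_Product.transpose_def vec_eq_iff)

lemma transpose_diff: "Finite_Cartesian_Product.transpose (A - B) =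
    Finite_Cartesian_Product.transpose A - Finite_Cartesian_Product.transpose B"
  by (simp add: Finite_Cartesian_Product.transpose_def vec_eq_iff)

lemma transpose_mult_nth:
  "(Finite_Cartesian_Product.transpose A ** B) $ i $ j = column i A \<bullet> column j (B :: real^'p^'n)"
  by (simp add: matrix_matrix_mult_def Finite_Cartesian_Product.transpose_def column_def inner_vec_def)

lemma vector_matrix_mult_nth: "(v v* A) $ i = column i A \<bullet> (v :: real^'n)"
  by (simp add: vector_matrix_mult_def column_def inner_vec_def mult.commute)

lemma column_hcat [simp]:
  "column (Inl j) (hcat A B) = column j A" "column (Inr j) (hcat A B) = column j B"
  by (simp_all add: column_def hcat_def)

lemma gram_nth: "gram A $ i $ j = column i A \<bullet> column j A"
  by (simp add: gram_def transpose_mult_nth)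

text \<open>Orthogonality of \<open>U\<close> and \<open>X\<close> removes the mixed terms. What
  remains of the second block is \<open>gram X - 2 S + S J S\<close> plus \<open>gram C\<close>,
  with \<open>S\<close> the diagonal matrix and \<open>J\<close> the inverse of
  \<open>gram X\<close>; the equation for \<open>C\<close> is made to cancel the excess.\<close>

lemma knockoff_gram:
  fixes X U :: "real^'p::finite^'n::finite" and C :: "real^'p^'p"
  assumes inv: "invertible (gram X)"
    and U: "gram U = mat 1"
    and UX: "Finite_Cartesian_Product.transpose U ** X = 0"
    and C: "gram C = 2 *\<^sub>R diag_mat s - diag_mat s ** matrix_inv (gram X) ** diag_mat s"
  shows "Finite_Cartesian_Product.transpose X ** knockoff_matrix X s U C = gram X - diag_mat s"
    and "gram (knockoff_matrix X s U C) = gram X"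
proof -
  let ?t = Finite_Cartesian_Product.transpose
  let ?S = "diag_mat s" and ?K = "knockoff_matrix X s U C"
  define J where "J = matrix_inv (gram X)"
  have J: "gram X ** J = mat 1" "J ** gram X = mat 1"
    using someI_ex[OF inv[unfolded invertible_def]] by (simp_all add: J_def matrix_inv_def)
  have tS: "?t ?S = ?S" by (simp add: diag_mat_def Finite_Cartesian_Product.transpose_def vec_eq_iff)
  have tG: "?t (gram X) = gram X" by (simp add: gram_def matrix_transpose_mul)
  have tJ: "?t J = J"
  proof -
    have "?t J ** gram X = mat 1" using J(1) by (metis matrix_transpose_mul tG transpose_mat)
    then have "?t J ** (gram X ** J) = J" by (simp add: matrix_mul_assoc)
    then show ?thesis by (simp add: J)
  qed
  have XU: "?t X ** U = 0"
    using arg_cong[OF UX, of ?t] by (simp add: matrix_transpose_mul)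
      (simp add: Finite_Cartesian_Product.transpose_def zero_vec_def)
  have K: "?K = X ** (mat 1 - J ** ?S) + U ** C" by (simp add: knockoff_matrix_def J_def)
  show XK: "?t X ** ?K = gram X - ?S"
  proof -
    have "?t X ** ?K = gram X ** (mat 1 - J ** ?S) + (?t X ** U) ** C"
      unfolding K gram_def by (simp add: matrix_add_ldistrib matrix_mul_assoc)
    also have "\<dots> = gram X - (gram X ** J) ** ?S"
      by (simp add: XU matrix_diff_ldistrib matrix_mul_assoc)
    finally show ?thesis by (simp add: J)
  qed
  have UK: "?t U ** ?K = C"
  proof -
    have "?t U ** ?K = (?t U ** X) ** (mat 1 - J ** ?S) + gram U ** C"
      unfolding K gram_def by (simp add: matrix_add_ldistrib matrix_mul_assoc)
    then show ?thesis by (simp add: UX U)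
  qed
  have "?t ?K = (mat 1 - ?S ** J) ** ?t X + ?t C ** ?t U"
    unfolding K by (simp add: transpose_add transpose_diff matrix_transpose_mul tS tJ transpose_mat)
  then have "gram ?K = (mat 1 - ?S ** J) ** (?t X ** ?K) + ?t C ** (?t U ** ?K)"
    unfolding gram_def by (simp add: matrix_add_rdistrib matrix_mul_assoc)
  also have "\<dots> = (mat 1 - ?S ** J) ** (gram X - ?S) + gram C"
    unfolding XK UK gram_def ..
  also have "(mat 1 - ?S ** J) ** (gram X - ?S) = gram X - ?S - (?S - ?S ** J ** ?S)"
    by (simp add: matrix_diff_ldistrib matrix_diff_rdistrib matrix_mul_assoc[symmetric] J)
  finally show "gram ?K = gram X" by (simp add: C J_def[symmetric] scaleR_2)
qed

text \<open>Householder reflection in the hyperplane orthogonal to \<open>u\<close>. For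
  \<open>u = 0\<close> division by zero yields the identity, the right map when a column equals its
  knockoff.\<close>

definition reflect_along :: "'a::real_inner \<Rightarrow> 'a \<Rightarrow> 'a" where
  "reflect_along u v = v - (2 * (u \<bullet> v) / (u \<bullet> u)) *\<^sub>R u"

lemma reflect_along_inner: "reflect_along u v \<bullet> x = v \<bullet> x - 2 * (u \<bullet> v) / (u \<bullet> u) * (u \<bullet> x)"
  by (simp add: reflect_along_def inner_diff_left)

lemma reflect_along_involution: "reflect_along u (reflect_along u v) = v"
  by (cases "u = 0") (simp_all add: reflect_along_def inner_diff_right)

lemma orthogonal_transformation_reflect_along: "orthogonal_transformation (reflect_along u)"
proof -
  have "linear (reflect_along u)"
    by (rule linearI) (simp_all add: reflect_along_def algebra_simps add_divide_distrib)
  moreover have "reflect_along u v \<bullet> reflect_along u x = v \<bullet> x" for v x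
    by (cases "u = 0") (simp_all add: reflect_along_def inner_diff_left inner_diff_right inner_commute)
  ultimately show ?thesis by (simp add: orthogonal_transformation_def)
qed

text \<open>Reflection preserves the norm, so the quadratic terms cancel and only the inner products
  with \<open>m\<close> survive.\<close>

lemma norm_reflect_along_diff:
  "(norm (reflect_along u v - m))\<^sup>2 - (norm (v - m))\<^sup>2 = 2 * (v \<bullet> m - reflect_along u v \<bullet> m)"
proof -
  have "norm (reflect_along u v) = norm v"
    using orthogonal_transformation_norm[OF orthogonal_transformation_reflect_along] .
  then have "reflect_along u v \<bullet> reflect_along u v = v \<bullet> v" by (metis dot_square_norm)
  then show ?thesis
    by (simp add: power2_norm_eq_inner inner_diff_left inner_diff_right inner_commute[of m v]
        inner_commute[of m "reflect_along u v"])
qed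

text \<open>By the Gram identities \<open>u\<close> is orthogonal to every column other than the
  \<open>j\<close>-th and its knockoff, and those two have equal norm, so the reflection just
  exchanges them. The mean \<open>X *v \<beta>\<close> meets \<open>u\<close> only through
  \<open>\<beta> $ j\<close>.\<close>

lemma reflect_along_knockoff:
  fixes X Xt :: "real^'p::finite^'n::finite" and j :: 'p
  assumes XXt: "Finite_Cartesian_Product.transpose X ** Xt = gram X - diag_mat s"
    and XtXt: "gram Xt = gram X"
  defines "A \<equiv> Finite_Cartesian_Product.transpose (hcat X Xt)"
    and "u \<equiv> column j X - column j Xt"
  shows "A *v reflect_along u v = swap_vec {j} (A *v v)"
    and "v \<bullet> (X *v \<beta>) - reflect_along u v \<bullet> (X *v \<beta>) = \<beta> $ j * ((A *v v) $ Inl j - (A *v v) $ Inr j)"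
proof -
  have d: "diag_mat s $ i $ k = (if i = k then s $ i else 0)" for i k by (simp add: diag_mat_def)
  have a: "column i X \<bullet> column k Xt = column i X \<bullet> column k X - (if i = k then s $ i else 0)" for i k
    using arg_cong[OF XXt, of "\<lambda>M. M $ i $ k"] by (simp add: transpose_mult_nth gram_nth d)
  have b: "column i Xt \<bullet> column k Xt = column i X \<bullet> column k X" for i k
    using arg_cong[OF XtXt, of "\<lambda>M. M $ i $ k"] by (simp add: gram_nth)
  have a': "column i Xt \<bullet> column k X = column i X \<bullet> column k X - (if i = k then s $ i else 0)" for i k
    using a[of k i] by (auto simp: inner_commute)
  have uX: "u \<bullet> column k X = (if k = j then s $ j else 0)" for k
    by (simp add: u_def inner_diff_left a')
  have uXt: "u \<bullet> column k Xt = (if k = j then - s $ j else 0)" for k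
    by (simp add: u_def inner_diff_left a b)
  have "u \<bullet> u = u \<bullet> column j X - u \<bullet> column j Xt"
    by (subst (2) u_def) (simp add: inner_diff_right)
  then have uu: "u \<bullet> u = 2 * s $ j" by (simp add: uX uXt)
  have uv: "u \<bullet> v = column j X \<bullet> v - column j Xt \<bullet> v"
    by (simp add: u_def inner_diff_left)
  \<comment> \<open>Here \<open>u \<bullet> u\<close> is \<open>2 * s $ j\<close>; when that is
    zero, \<open>u\<close> vanishes and both sides are \<open>0\<close>.\<close>
  have coeff: "2 * (u \<bullet> v) / (u \<bullet> u) * s $ j = u \<bullet> v"
  proof (cases "s $ j = 0")
    case True
    then have "u = 0" using uu by simp
    then show ?thesis by simp
  qed (simp add: uu)
  have X: "column k X \<bullet> reflect_along u v = column k X \<bullet> v - (if k = j then u \<bullet> v else 0)" for k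
    using coeff by (simp add: inner_commute[of "column k X"] reflect_along_inner uX)
  have Xt: "column k Xt \<bullet> reflect_along u v = column k Xt \<bullet> v + (if k = j then u \<bullet> v else 0)" for k
    using coeff by (simp add: inner_commute[of "column k Xt"] reflect_along_inner uXt)
  have "(A *v reflect_along u v) $ k = swap_vec {j} (A *v v) $ k" for k
    by (cases k) (auto simp: swap_vec_def swap_index_def A_def vector_matrix_mult_nth X Xt uv)
  then show "A *v reflect_along u v = swap_vec {j} (A *v v)" by (simp add: vec_eq_iff)
  have "u \<bullet> (X *v \<beta>) = (\<Sum>k\<in>UNIV. \<beta> $ k * (u \<bullet> column k X))"
    by (simp add: matrix_mult_sum inner_sum_right scalar_mult_eq_scaleR)
  also have "\<dots> = \<beta> $ j * s $ j" by (simp add: uX if_distrib cong: if_cong)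
  finally have u\<beta>: "u \<bullet> (X *v \<beta>) = \<beta> $ j * s $ j" .
  have "v \<bullet> (X *v \<beta>) - reflect_along u v \<bullet> (X *v \<beta>) = \<beta> $ j * (2 * (u \<bullet> v) / (u \<bullet> u) * s $ j)"
    by (simp add: reflect_along_inner u\<beta>)
  then show "v \<bullet> (X *v \<beta>) - reflect_along u v \<bullet> (X *v \<beta>) = \<beta> $ j * ((A *v v) $ Inl j - (A *v v) $ Inr j)"
    unfolding coeff by (simp add: A_def vector_matrix_mult_nth uv)
qed

section \<open>From single swaps to the bound on the false discovery rate\<close>

lemma swap_matrix_mult: "swap_matrix i *v z = swap_vec {i} z"
proof -
  have "(\<Sum>l\<in>UNIV. (if l = m then 1 else 0) * z $ l) = z $ m" for m
    by (simp add: if_distrib[of "\<lambda>c. c * _"] cong: if_cong)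
  then show ?thesis
    by (simp add: vec_eq_iff swap_matrix_def matrix_vector_mult_def swap_vec_def)
qed

text \<open>The inserted \<open>0\<close> never exceeds a nonnegative
  \<open>\<epsilon>\<close>.\<close>

lemma max_over_gt_iff:
  "0 \<le> \<epsilon> \<Longrightarrow> max_over (H :: 'p::finite set) f > \<epsilon> \<longleftrightarrow> (\<exists>j\<in>H. f j > \<epsilon>)"
  unfolding max_over_def by (subst Max_gr_iff) auto

theorem theorem4:
  fixes M :: "'a measure"
    and X Xt U :: "real^'p::finite^'n::finite"
    and C :: "real^'p^'p"
    and s \<beta> \<delta> :: "real^'p"
    and w y :: "'a \<Rightarrow> real^'n"
    and \<sigma> q :: real
    and G :: "real^('p + 'p)^('p + 'p)"
    and z :: "'a \<Rightarrow> real^('p + 'p)"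
    and E :: "real^('p + 'p)^('p + 'p) \<Rightarrow> real^('p + 'p) \<Rightarrow> real^('p + 'p)"
    and W :: "real^('p + 'p) \<Rightarrow> real^'p"
    and H0 :: "'p set"
    and R :: "'a \<Rightarrow> 'p set"
  assumes "prob_space M"
    and "0 < \<sigma>"
    and "isotropic_gaussian M w \<sigma>"
    and "2 * CARD('p) \<le> CARD('n)"
    and "\<And>j. norm (column j X) = 1"
    and "invertible (gram X)"
    and y: "y = (\<lambda>\<omega>. X *v \<beta> + w \<omega>)"
    and "\<And>j. 0 \<le> s $ j"
    and "diag_mat s \<preceq>\<^sub>L 2 *\<^sub>R gram X"
    and "gram U = mat 1"
    and "Finite_Cartesian_Product.transpose U ** X = 0"
    and "gram C = 2 *\<^sub>R diag_mat s - diag_mat s ** matrix_inv (gram X) ** diag_mat s"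
    and Xt: "Xt = knockoff_matrix X s U C"
    and G: "G = gram (hcat X Xt)"
    and z: "z = (\<lambda>\<omega>. Finite_Cartesian_Product.transpose (hcat X Xt) *v y \<omega>)"
    and "E G \<in> borel_measurable borel"
    and "swap_equivariant (E G)"
    and "W \<in> borel_measurable borel"
    and "antisymmetric_statistics W"
    and "0 \<le> q" and "q \<le> 1"
    and "\<And>j. 0 \<le> \<delta> $ j"
    and H0: "H0 = {i. \<bar>\<beta> $ i\<bar> \<le> \<delta> $ i}"
    and R: "R = (\<lambda>\<omega>. knockoff_select q (W (E G (z \<omega>))))"
  shows "FDR M R H0 \<le>
    (INF \<epsilon>\<in>{0..}. q * exp \<epsilon> +
       measure M {\<omega> \<in> space M.
         1 / \<sigma>\<^sup>2 * max_over H0 (\<lambda>j. \<delta> $ j * \<bar>z \<omega> $ Inl j - z \<omega> $ Inr j\<bar>) > \<epsilon>})"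
proof -
  note \<sigma> = \<open>0 < \<sigma>\<close> and w = \<open>isotropic_gaussian M w \<sigma>\<close> and q = \<open>0 \<le> q\<close>
  interpret prob_space M by fact
  define A where "A = Finite_Cartesian_Product.transpose (hcat X Xt)"
  define \<mu> where "\<mu> = X *v \<beta>"
  define F where "F v = W (E G (A *v v))" for v
  define D where "D j v = \<delta> $ j * \<bar>(A *v v) $ Inl j - (A *v v) $ Inr j\<bar> / \<sigma>\<^sup>2" for j v
  define FDP where "FDP v = real (card (knockoff_select q (F v) \<inter> H0)) /
    real (max (card (knockoff_select q (F v))) 1)" for v
  have XXt: "Finite_Cartesian_Product.transpose X ** Xt = gram X - diag_mat s" and XtXt: "gram Xt = gram X"
    unfolding Xt by (rule knockoff_gram; fact)+
  have z': "z \<omega> = A *v (\<mu> + w \<omega>)" for \<omega> by (simp add: z y A_def \<mu>_def)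
  have [measurable]: "w \<in> borel_measurable M"
    using w unfolding isotropic_gaussian_def by (auto dest: distributed_measurable)
  have A[measurable]: "(\<lambda>v. A *v v) \<in> borel_measurable borel"
    by (intro borel_measurable_continuous_onI linear_continuous_on matrix_vector_mul_bounded_linear)
  have [measurable]: "F \<in> borel_measurable borel"
    unfolding F_def using A \<open>E G \<in> borel_measurable borel\<close> \<open>W \<in> borel_measurable borel\<close> by measurable
  have [measurable]: "D j \<in> borel_measurable borel" for j
    unfolding D_def by measurable
  have [measurable]: "FDP \<in> borel_measurable borel"
    unfolding FDP_def by measurable

  \<comment> \<open>For one null \<open>j\<close>, the weight on the event of a positive statistic
    is traded for the weight on the event of a negative one. The condition on \<open>D\<close>
    confines the trade to points where the density ratio is under control.\<close>
  have swap: "(\<integral>\<^sup>+\<omega>. ennreal (if 0 < F (\<mu> + w \<omega>) $ j \<and> D j (\<mu> + w \<omega>) \<le> \<epsilon>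
        then knockoff_weight q H0 j (F (\<mu> + w \<omega>)) else 0) \<partial>M)
      \<le> ennreal (exp \<epsilon>) * (\<integral>\<^sup>+\<omega>. ennreal (if F (\<mu> + w \<omega>) $ j < 0
        then knockoff_weight q H0 j (F (\<mu> + w \<omega>)) else 0) \<partial>M)"
    (is "?L \<le> _ * ?N") if j: "j \<in> H0" for j \<epsilon>
  proof -
    define Q where "Q = reflect_along (column j X - column j Xt)"
    define f where "f v = ennreal (if 0 < F v $ j \<and> D j v \<le> \<epsilon> then knockoff_weight q H0 j (F v) else 0)" for v
    have FQ: "F (Q v) = (\<chi> k. if k = j then - (F v $ k) else F v $ k)" for v
    proof -
      have "E G (A *v Q v) = swap_vec {j} (E G (A *v v))"
        using \<open>swap_equivariant (E G)\<close> reflect_along_knockoff(1)[OF XXt XtXt]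
        by (simp add: Q_def A_def swap_equivariant_def swap_matrix_mult)
      then show ?thesis
        using \<open>antisymmetric_statistics W\<close> unfolding F_def antisymmetric_statistics_def by simp
    qed
    have "?L \<le> ennreal (exp \<epsilon>) * (\<integral>\<^sup>+\<omega>. f (Q (\<mu> + w \<omega>)) \<partial>M)"
      unfolding f_def[symmetric]
    proof (rule gaussian_reflection_comparison[OF w \<sigma>])
      show "orthogonal_transformation Q" unfolding Q_def by (rule orthogonal_transformation_reflect_along)
      show "Q (Q v) = v" for v unfolding Q_def by (rule reflect_along_involution)
      show "f \<in> borel_measurable borel" unfolding f_def by measurable
      fix v assume "f v \<noteq> 0"
      then have "D j v \<le> \<epsilon>" by (auto simp: f_def split: if_splits)
      let ?d = "(A *v v) $ Inl j - (A *v v) $ Inr j"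
      have "v \<bullet> \<mu> - Q v \<bullet> \<mu> = \<beta> $ j * ?d"
        unfolding Q_def \<mu>_def A_def by (rule reflect_along_knockoff(2)[OF XXt XtXt])
      also have "\<dots> \<le> \<bar>\<beta> $ j\<bar> * \<bar>?d\<bar>" by (metis abs_ge_self abs_mult)
      also have "\<dots> \<le> \<delta> $ j * \<bar>?d\<bar>" using j by (intro mult_right_mono) (auto simp: H0)
      also have "\<dots> \<le> \<sigma>\<^sup>2 * \<epsilon>" using \<open>D j v \<le> \<epsilon>\<close> \<sigma> by (simp add: D_def field_simps)
      finally show "(norm (Q v - \<mu>))\<^sup>2 - (norm (v - \<mu>))\<^sup>2 \<le> 2 * \<sigma>\<^sup>2 * \<epsilon>"
        unfolding Q_def norm_reflect_along_diff by simp
    qed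
    \<comment> \<open>The reflection turns the positive sign into a negative one and keeps the
      weight; dropping the condition on \<open>D\<close> can only increase the integral.\<close>
    also have "(\<integral>\<^sup>+\<omega>. f (Q (\<mu> + w \<omega>)) \<partial>M) \<le> ?N"
      by (intro nn_integral_mono)
        (simp add: f_def FQ knockoff_weight_flip knockoff_weight_nonneg)
    finally show ?thesis by (simp add: mult_left_mono)
  qed

  have "FDR M R H0 \<le> q * exp \<epsilon> + measure M {\<omega> \<in> space M.
      1 / \<sigma>\<^sup>2 * max_over H0 (\<lambda>j. \<delta> $ j * \<bar>z \<omega> $ Inl j - z \<omega> $ Inr j\<bar>) > \<epsilon>}"
    if \<epsilon>: "0 \<le> \<epsilon>" for \<epsilon>
  proof -
    define B where "B = {\<omega> \<in> space M. \<exists>j\<in>H0. D j (\<mu> + w \<omega>) > \<epsilon>}"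
    have [measurable]: "B \<in> sets M" unfolding B_def by measurable
    have B: "{\<omega> \<in> space M. 1 / \<sigma>\<^sup>2 * max_over H0 (\<lambda>j. \<delta> $ j * \<bar>z \<omega> $ Inl j - z \<omega> $ Inr j\<bar>) > \<epsilon>} = B"
    proof -
      have "1 / \<sigma>\<^sup>2 * m > \<epsilon> \<longleftrightarrow> m > \<sigma>\<^sup>2 * \<epsilon>" "m / \<sigma>\<^sup>2 > \<epsilon> \<longleftrightarrow> m > \<sigma>\<^sup>2 * \<epsilon>" for m
        using \<sigma> by (simp_all add: field_simps)
      then show ?thesis using \<epsilon> by (simp add: B_def D_def z' max_over_gt_iff)
    qed
    let ?p = "\<lambda>j \<omega>. if 0 < F (\<mu> + w \<omega>) $ j \<and> D j (\<mu> + w \<omega>) \<le> \<epsilon>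
        then knockoff_weight q H0 j (F (\<mu> + w \<omega>)) else 0"
    let ?n = "\<lambda>j \<omega>. if F (\<mu> + w \<omega>) $ j < 0 then knockoff_weight q H0 j (F (\<mu> + w \<omega>)) else 0"
    \<comment> \<open>On \<open>B\<close> the trivial bound \<open>1\<close> is absorbed by the
      indicator; off \<open>B\<close> every null satisfies the condition on \<open>D\<close>, so the
      restricted sum is the full one.\<close>
    have FDP: "FDP (\<mu> + w \<omega>) \<le> q * (\<Sum>j\<in>H0. ?p j \<omega>) + indicator B \<omega>" if "\<omega> \<in> space M" for \<omega>
    proof (cases "\<omega> \<in> B")
      case True
      have "card (knockoff_select q (F (\<mu> + w \<omega>)) \<inter> H0) \<le> card (knockoff_select q (F (\<mu> + w \<omega>)))"
        by (rule card_mono) auto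
      then have "FDP (\<mu> + w \<omega>) \<le> 1" by (simp add: FDP_def)
      moreover have "0 \<le> q * (\<Sum>j\<in>H0. ?p j \<omega>)"
        using q by (intro mult_nonneg_nonneg sum_nonneg) (auto simp: knockoff_weight_nonneg)
      ultimately show ?thesis using True by simp
    next
      case False
      then have "(\<Sum>j\<in>H0. ?p j \<omega>) = (\<Sum>j\<in>H0. if 0 < F (\<mu> + w \<omega>) $ j then knockoff_weight q H0 j (F (\<mu> + w \<omega>)) else 0)"
        using that by (intro sum.cong) (auto simp: B_def not_less)
      then show ?thesis using FDP_le_sum_weights[OF q, of "F (\<mu> + w \<omega>)" H0] False by (simp add: FDP_def)
    qed
    have "(\<integral>\<^sup>+\<omega>. ennreal (FDP (\<mu> + w \<omega>)) \<partial>M)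
        \<le> (\<integral>\<^sup>+\<omega>. ennreal q * (\<Sum>j\<in>H0. ennreal (?p j \<omega>)) + indicator B \<omega> \<partial>M)"
    proof (rule nn_integral_mono)
      fix \<omega> assume "\<omega> \<in> space M"
      have "ennreal (FDP (\<mu> + w \<omega>)) \<le> ennreal (q * (\<Sum>j\<in>H0. ?p j \<omega>) + indicator B \<omega>)"
        by (intro ennreal_leI FDP) fact
      also have "\<dots> = ennreal q * (\<Sum>j\<in>H0. ennreal (?p j \<omega>)) + indicator B \<omega>"
        using q by (simp add: ennreal_plus ennreal_mult sum_nonneg knockoff_weight_nonneg ennreal_indicator)
      finally show "ennreal (FDP (\<mu> + w \<omega>)) \<le> ennreal q * (\<Sum>j\<in>H0. ennreal (?p j \<omega>)) + indicator B \<omega>" .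
    qed
    also have "\<dots> = ennreal q * (\<Sum>j\<in>H0. \<integral>\<^sup>+\<omega>. ennreal (?p j \<omega>) \<partial>M) + emeasure M B"
      by (simp add: nn_integral_add nn_integral_cmult nn_integral_sum)
    also have "\<dots> \<le> ennreal q * (\<Sum>j\<in>H0. ennreal (exp \<epsilon>) * (\<integral>\<^sup>+\<omega>. ennreal (?n j \<omega>) \<partial>M)) + emeasure M B"
      by (intro add_right_mono mult_left_mono sum_mono swap) simp_all
    \<comment> \<open>The bound \<open>1\<close> holds for the sum over all nulls pointwise, so the
      sum goes back inside the integral.\<close>
    also have "(\<Sum>j\<in>H0. ennreal (exp \<epsilon>) * (\<integral>\<^sup>+\<omega>. ennreal (?n j \<omega>) \<partial>M))
        = ennreal (exp \<epsilon>) * (\<integral>\<^sup>+\<omega>. ennreal (\<Sum>j\<in>H0. ?n j \<omega>) \<partial>M)"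
      by (simp add: sum_distrib_left[symmetric] nn_integral_sum[symmetric] knockoff_weight_nonneg)
    also have "(\<integral>\<^sup>+\<omega>. ennreal (\<Sum>j\<in>H0. ?n j \<omega>) \<partial>M) \<le> (\<integral>\<^sup>+\<omega>. 1 \<partial>M)"
      by (intro nn_integral_mono) (simp add: sum_negative_weights_le_1)
    also have "\<dots> = 1" by (simp add: emeasure_space_1)
    finally have "(\<integral>\<^sup>+\<omega>. ennreal (FDP (\<mu> + w \<omega>)) \<partial>M) \<le> ennreal (q * exp \<epsilon> + measure M B)"
      using q by (simp add: mult_left_mono ennreal_plus ennreal_mult emeasure_eq_measure)
    \<comment> \<open>The estimate was made for nonnegative integrals; nonnegativity and
      measurability of \<open>FDP\<close> convert it to the real integral in
      \<open>FDR\<close>.\<close>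
    moreover have "FDR M R H0 = enn2real (\<integral>\<^sup>+\<omega>. ennreal (FDP (\<mu> + w \<omega>)) \<partial>M)"
      unfolding FDR_def R z' F_def[symmetric] FDP_def[symmetric]
      by (rule integral_eq_nn_integral) (measurable, simp add: FDP_def)
    ultimately show ?thesis unfolding B using q by (simp add: enn2real_leI)
  qed
  then show ?thesis by (intro cINF_greatest) auto
qed

end
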